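(* Let $K_1,\ldots,K_n$ ($n\ge 2$) be non-empty closed convex subsets of $d$-dimensional Euclidean space $(\mathbb{E}^d,\|\cdot\|)$, and let $\bar{x}\in\mathbb{E}^d$, where $K_{n-1}=\{\bar{x}\}\subseteq K_n$, $\bar{x}\notin\bigcup_{i=1}^{n-2}K_i$, and $K_n$ is an affine flat of dimension $\dim(K_n)\in\{1,\ldots,d-1\}$. Moreover, let $$v=\sum_{i=1}^{n-2}\frac{\mathrm{proj}(\bar{x},K_i)-\bar{x}}{\|\mathrm{proj}(\bar{x},K_i)-\bar{x}\|},$$ let $\alpha\in[0,\frac{\pi}{2}]$ be the angle between $v$ and $K_n$ if $v\ne 0$, and put $\alpha=0$ if $v=0$. Then the following are equivalent. (a) $\bar{x}$ is a minimizer of $f:\mathbb{E}^d\to\mathbb{R}$, $f(x)=\sum_{i=1}^n\mathrm{dist}(x,K_i)$. (b) $v\in\left((K_n-\bar{x})^\perp\cap B(0,1)\right)+B(0,1)$. (c) $$\|v\|\le\begin{cases}\frac{1}{\cos\alpha}&\text{if }0\le\alpha\le\frac{\pi}{4},\\ 2\sin\alpha&\text{if }\frac{\pi}{4}\le\alpha\le\frac{\pi}{2}.\end{cases}$$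
   Context: $\mathrm{dist}(x,K)=\inf\{\|y-x\|:y\in K\}$ is the Euclidean distance, and $\mathrm{proj}(x,K)$ is the unique point of the non-empty closed convex set $K$ nearest to $x$. An affine flat is an affine subspace. $B(0,1)$ is the closed Euclidean unit ball; the sum of sets is the Minkowski sum. $(K_n-\bar{x})^\perp$ is the orthogonal complement of the linear subspace $V=K_n-\bar{x}$. The angle between $v\neq0$ and $K_n$ is the angle $\alpha\in[0,\frac{\pi}{2}]$ between $v$ and the linear subspace $V$, i.e. $\cos\alpha=\|v|_V\|/\|v\|$ and $\sin\alpha=\|v|_{V^\perp}\|/\|v\|$, where $v|_V$ and $v|_{V^\perp}$ are the orthogonal projections of $v$ onto $V$ and $V^\perp$. An empty sum is $0$. *)

theory Defs
  imports "HOL-Analysis.Analysis"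
begin

definition orth_proj :: "'a::euclidean_space set \<Rightarrow> 'a \<Rightarrow> 'a" where
  "orth_proj V v = (THE y. y \<in> V \<and> v - y \<in> V\<^sup>\<bottom>)"

lemma orth_proj_unique:
  assumes "subspace V" and "y \<in> V" and "v - y \<in> V\<^sup>\<bottom>"
  shows "orth_proj V v = y"
  unfolding orth_proj_def
proof (rule the_equality)
  show "y \<in> V \<and> v - y \<in> V\<^sup>\<bottom>" using assms by simp
next
  fix z assume z: "z \<in> V \<and> v - z \<in> V\<^sup>\<bottom>"
  have V: "z - y \<in> V" using assms z by (simp add: subspace_diff)
  have "(v - y) - (v - z) \<in> V\<^sup>\<bottom>"
    using assms z subspace_orthogonal_comp by (blast intro: subspace_diff)
  then have "z - y \<in> V\<^sup>\<bottom>" by simp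
  then have "orthogonal (z - y) (z - y)" using V by (simp add: orthogonal_comp_def)
  then show "z = y" by (simp add: orthogonal_self)
qed

lemma orth_proj:
  assumes "subspace V"
  shows "orth_proj V v \<in> V" and "v - orth_proj V v \<in> V\<^sup>\<bottom>"
proof -
  obtain y z where y: "y \<in> span V" and z: "\<And>w. w \<in> span V \<Longrightarrow> orthogonal z w" and v: "v = y + z"
    by (rule orthogonal_subspace_decomp_exists[of V v]) blast
  have "y \<in> V" using y assms by (metis span_eq_iff)
  moreover have "v - y \<in> V\<^sup>\<bottom>"
    using z v by (simp add: orthogonal_comp_def orthogonal_commute span_base)
  ultimately show "orth_proj V v \<in> V" "v - orth_proj V v \<in> V\<^sup>\<bottom>"
    using orth_proj_unique[OF assms] by auto
qed

lemma orth_proj_orthogonal_comp: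
  assumes "subspace V"
  shows "orth_proj (V\<^sup>\<bottom>) v = v - orth_proj V v"
  using orth_proj[OF assms, of v] assms
  by (intro orth_proj_unique) (simp_all add: subspace_orthogonal_comp orthogonal_comp_self)

text \<open>The angle between a vector \<open>v \<noteq> 0\<close> and a linear subspace \<open>V\<close>; for \<open>v = 0\<close> the value is
  the meaningless \<open>arccos 0\<close>.\<close>

definition subspace_angle :: "'a::euclidean_space \<Rightarrow> 'a set \<Rightarrow> real" where
  "subspace_angle v V = arccos (norm (orth_proj V v) / norm v)"

lemma norm_orth_proj_Pythagorean:
  assumes "subspace V"
  shows "(norm v)\<^sup>2 = (norm (orth_proj V v))\<^sup>2 + (norm (orth_proj (V\<^sup>\<bottom>) v))\<^sup>2"
proof -
  have "orthogonal (orth_proj V v) (v - orth_proj V v)"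
    using orth_proj[OF assms, of v] by (simp add: orthogonal_comp_def)
  from norm_add_Pythagorean[OF this] show ?thesis
    by (simp add: orth_proj_orthogonal_comp[OF assms])
qed

lemma subspace_angle:
  assumes "subspace V" and "v \<noteq> 0"
  shows "subspace_angle v V \<in> {0..pi/2}"
    and "cos (subspace_angle v V) = norm (orth_proj V v) / norm v"
    and "sin (subspace_angle v V) = norm (orth_proj (V\<^sup>\<bottom>) v) / norm v"
proof -
  let ?a = "norm (orth_proj V v)" and ?b = "norm (orth_proj (V\<^sup>\<bottom>) v)"
  have py: "(norm v)\<^sup>2 = ?a\<^sup>2 + ?b\<^sup>2" by (rule norm_orth_proj_Pythagorean[OF assms(1)])
  have "?a\<^sup>2 \<le> (norm v)\<^sup>2" using py by simp
  then have "?a \<le> norm v" by (rule power2_le_imp_le) simp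
  then have le: "0 \<le> ?a / norm v" "?a / norm v \<le> 1" using assms(2) by simp_all
  have ge: "- 1 \<le> ?a / norm v" using le(1) by (rule order_trans[rotated]) simp
  show "subspace_angle v V \<in> {0..pi/2}"
    unfolding subspace_angle_def
    using arccos_lbound[OF ge le(2)] arccos_le_pi2[OF le] by simp
  show "cos (subspace_angle v V) = ?a / norm v"
    unfolding subspace_angle_def using ge le(2) by (rule cos_arccos)
  have "1 - (?a / norm v)\<^sup>2 = (?b / norm v)\<^sup>2"
  proof -
    have b: "?b\<^sup>2 = (norm v)\<^sup>2 - ?a\<^sup>2" using py by simp
    show ?thesis using assms(2) by (simp add: power_divide b diff_divide_distrib)
  qed
  then show "sin (subspace_angle v V) = ?b / norm v"
    unfolding subspace_angle_def sin_arccos[OF ge le(2)] by simp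
qed

end

theory Submission
  imports Defs
begin

text \<open>
  Write \<open>V = K n - xbar\<close> and let \<open>P\<close>, \<open>Q\<close> be the orthogonal projections onto \<open>V\<close> and its
  orthogonal complement. Near \<open>xbar\<close> every term of \<open>f\<close> is explicit to first order. For
  \<open>i \<le> n - 2\<close> the distance to \<open>K i\<close> is smooth at \<open>xbar\<close>, with gradient \<open>- u\<close>, where \<open>u\<close> is the
  unit vector pointing from \<open>xbar\<close> to its nearest point of \<open>K i\<close>. The last two terms,
  \<open>norm w\<close> and \<open>norm (Q w)\<close> as functions of the displacement \<open>w\<close>, are positively homogeneous.
  So the directional derivative of \<open>f\<close> at \<open>xbar\<close> along \<open>w\<close> is \<open>norm w + norm (Q w) - v \<bullet> w\<close>,
  and by convexity \<open>xbar\<close> is a minimizer iff this is nonnegative for all \<open>w\<close>. Lemmas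
  \<open>infdist_ge_supporting\<close> and \<open>infdist_le_quadratic\<close> give the two bounds on the smooth terms, and
  \<open>minimizer_iff_linear_bound\<close> passes from \<open>f\<close> to the linear condition.

  The function \<open>norm w + norm (Q w)\<close> is the support function of the Minkowski sum in (b), so the
  linear condition says that \<open>v\<close> lies in that compact convex set. Instead of a
  separation theorem, \<open>linear_bound_iff_mem_sum\<close> tests with one vector \<open>w\<close>: the difference of
  \<open>v\<close> and the point of \<open>V\<^sup>\<bottom> \<inter> cball 0 1\<close> nearest to it.

  Finally \<open>mem_sum_iff\<close> expresses (b) through the lengths \<open>a = norm (P v)\<close> and \<open>b = norm (Q v)\<close>:
  the distance of \<open>v\<close> to \<open>V\<^sup>\<bottom> \<inter> cball 0 1\<close> is at most \<open>1\<close>. In the \<open>(a, b)\<close> quadrant this region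
  is bounded by the line \<open>a = 1\<close> up to \<open>b = 1\<close> and then by the unit circle around \<open>(0, 1)\<close>.
  The two pieces meet at \<open>(1, 1)\<close>, on the ray of angle \<open>pi / 4\<close>, and in polar coordinates their
  equations are \<open>norm v = 1 / cos \<alpha>\<close> and \<open>norm v = 2 * sin \<alpha>\<close>: this is (c).
\<close>

section \<open>First-order behaviour of the distance functions\<close>

text \<open>\<open>K\<close> is contained in the half-space that supports it at the point nearest to \<open>p\<close>. The
  affine function on the right is the signed distance of \<open>x\<close> to the boundary of this half-space.\<close>

lemma infdist_ge_supporting:
  fixes K :: "'a::euclidean_space set"
  assumes K: "K \<noteq> {}" "closed K" "convex K" and p: "p \<notin> K"
  defines "a \<equiv> closest_point K p - p"
  shows "infdist x K \<ge> norm a - (a /\<^sub>R norm a) \<bullet> (x - p)"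
proof -
  have a0: "a \<noteq> 0"
    using closest_point_in_set[OF K(2,1), of p] p unfolding a_def by auto
  have "norm a - (a /\<^sub>R norm a) \<bullet> (x - p) \<le> dist x y" if y: "y \<in> K" for y
  proof -
    have "(p - closest_point K p) \<bullet> (y - closest_point K p) \<le> 0"
      by (rule closest_point_dot[OF K(3,2) y])
    then have "a \<bullet> a \<le> a \<bullet> (y - p)"
      unfolding a_def by (simp add: algebra_simps inner_commute)
    then have "norm a * norm a \<le> a \<bullet> (y - x) + a \<bullet> (x - p)"
      by (simp add: algebra_simps power2_norm_eq_inner[symmetric] power2_eq_square)
    also have "a \<bullet> (y - x) \<le> norm a * dist x y"
      using norm_cauchy_schwarz[of a "y - x"] by (simp add: dist_norm norm_minus_commute)
    finally have "norm a * norm a \<le> norm a * dist x y + a \<bullet> (x - p)" by simp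
    then show ?thesis using a0 by (simp add: field_simps)
  qed
  then show ?thesis
    using K(1) by (simp add: infdist_notempty cINF_greatest)
qed

text \<open>The distance to \<open>K\<close> is at most the distance to the point of \<open>K\<close> nearest to \<open>p\<close>. The
  inequality \<open>norm z \<le> ((norm z)\<^sup>2 + r\<^sup>2) / (2 * r)\<close> turns the latter into a quadratic in \<open>t\<close>; with
  \<open>r = norm a\<close> it is an equality at \<open>t = 0\<close>, so that the linear term is the true derivative.\<close>

lemma infdist_le_quadratic:
  fixes K :: "'a::euclidean_space set"
  assumes K: "K \<noteq> {}" "closed K" and p: "p \<notin> K"
  defines "a \<equiv> closest_point K p - p"
  shows "infdist (p + t *\<^sub>R w) K
    \<le> norm a - t * ((a /\<^sub>R norm a) \<bullet> w) + t\<^sup>2 * ((norm w)\<^sup>2 / (2 * norm a))"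
proof -
  have q: "closest_point K p \<in> K" by (rule closest_point_in_set[OF K(2,1)])
  then have a0: "norm a > 0" using p unfolding a_def by auto
  let ?z = "a - t *\<^sub>R w"
  have "infdist (p + t *\<^sub>R w) K \<le> dist (p + t *\<^sub>R w) (closest_point K p)"
    by (rule infdist_le[OF q])
  also have "\<dots> = norm ?z"
    unfolding a_def by (metis add.commute diff_diff_eq dist_commute dist_norm)
  also have "\<dots> \<le> ((norm ?z)\<^sup>2 + (norm a)\<^sup>2) / (2 * norm a)"
    using a0 sum_squares_bound[of "norm ?z" "norm a"] by (simp add: field_simps)
  also have "(norm ?z)\<^sup>2 = (norm a)\<^sup>2 - 2 * t * (a \<bullet> w) + t\<^sup>2 * (norm w)\<^sup>2"
    unfolding power2_norm_eq_inner
    by (simp add: algebra_simps inner_commute power2_eq_square del: dot_square_norm)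
  also have "(\<dots> + (norm a)\<^sup>2) / (2 * norm a)
      = norm a - t * ((a /\<^sub>R norm a) \<bullet> w) + t\<^sup>2 * ((norm w)\<^sup>2 / (2 * norm a))"
    using a0 by (simp add: field_simps power2_eq_square)
  finally show ?thesis .
qed

lemma infdist_closest_point:
  fixes K :: "'a::euclidean_space set"
  assumes "K \<noteq> {}" "closed K"
  shows "infdist p K = norm (closest_point K p - p)"
  using assms by (metis dist_commute dist_norm infdist_eq_setdist setdist_closest_point)

lemma norm_diff_Pythagorean_subspace:
  assumes V: "subspace V" and y: "y \<in> V"
  shows "(norm (w - y))\<^sup>2 = (norm (orth_proj V w - y))\<^sup>2 + (norm (orth_proj (V\<^sup>\<bottom>) w))\<^sup>2"
proof -
  have "orthogonal (orth_proj V w - y) (orth_proj (V\<^sup>\<bottom>) w)"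
    using orth_proj[OF V, of w] subspace_diff[OF V _ y]
    unfolding orth_proj_orthogonal_comp[OF V] by (simp add: orthogonal_comp_def)
  from norm_add_Pythagorean[OF this] show ?thesis
    by (simp add: orth_proj_orthogonal_comp[OF V])
qed

lemma infdist_flat:
  fixes K :: "'a::euclidean_space set" and p w :: 'a
  defines "V \<equiv> (\<lambda>y. y - p) ` K"
  assumes V: "subspace V"
  shows "infdist (p + w) K = norm (orth_proj (V\<^sup>\<bottom>) w)"
proof (rule antisym)
  obtain y where y: "y \<in> K" "orth_proj V w = y - p"
    using orth_proj(1)[OF V, of w] unfolding V_def by auto
  have "infdist (p + w) K \<le> dist (p + w) y" by (rule infdist_le[OF y(1)])
  also have "\<dots> = norm (orth_proj (V\<^sup>\<bottom>) w)"
    by (simp add: orth_proj_orthogonal_comp[OF V] y(2) dist_norm algebra_simps)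
  finally show "infdist (p + w) K \<le> norm (orth_proj (V\<^sup>\<bottom>) w)" .
next
  have "norm (orth_proj (V\<^sup>\<bottom>) w) \<le> dist (p + w) y" if "y \<in> K" for y
  proof -
    have "y - p \<in> V" using that unfolding V_def by blast
    from norm_diff_Pythagorean_subspace[OF V this, of w]
    have "(norm (orth_proj (V\<^sup>\<bottom>) w))\<^sup>2 \<le> (norm (w - (y - p)))\<^sup>2" by simp
    then have "norm (orth_proj (V\<^sup>\<bottom>) w) \<le> norm (w - (y - p))"
      by (rule power2_le_imp_le) simp
    then show ?thesis by (simp add: dist_norm algebra_simps)
  qed
  moreover have "K \<noteq> {}" using subspace_0[OF V] unfolding V_def by auto
  ultimately show "norm (orth_proj (V\<^sup>\<bottom>) w) \<le> infdist (p + w) K"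
    by (simp add: infdist_notempty cINF_greatest)
qed

section \<open>Minimality as a linear condition\<close>

lemma orth_proj_scaleR:
  assumes "subspace V"
  shows "orth_proj V (t *\<^sub>R w) = t *\<^sub>R orth_proj V w"
  using orth_proj[OF assms, of w] subspace_orthogonal_comp[of V] assms
  by (intro orth_proj_unique) (simp_all add: subspace_scale flip: scaleR_diff_right)

text \<open>The supporting half-spaces make the linear condition sufficient. It is necessary because
  the quadratic error terms disappear after division by \<open>t\<close> as \<open>t\<close> tends to \<open>0\<close>.\<close>

lemma minimizer_iff_linear_bound:
  fixes K :: "'i \<Rightarrow> 'a::euclidean_space set" and L :: "'a set"
  assumes I: "\<And>i. i \<in> I \<Longrightarrow> K i \<noteq> {} \<and> closed (K i) \<and> convex (K i) \<and> p \<notin> K i"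
  defines "V \<equiv> (\<lambda>y. y - p) ` L"
  assumes V: "subspace V"
  defines "u \<equiv> \<lambda>i. (closest_point (K i) p - p) /\<^sub>R norm (closest_point (K i) p - p)"
  defines "F \<equiv> \<lambda>x. (\<Sum>i\<in>I. infdist x (K i)) + dist x p + infdist x L"
  shows "(\<forall>x. F p \<le> F x)
    \<longleftrightarrow> (\<forall>w. (\<Sum>i\<in>I. u i) \<bullet> w \<le> norm w + norm (orth_proj (V\<^sup>\<bottom>) w))"
proof -
  define a where "a = (\<lambda>i. norm (closest_point (K i) p - p))"
  define v where "v = (\<Sum>i\<in>I. u i)"
  define g where "g = (\<lambda>w. norm w + norm (orth_proj (V\<^sup>\<bottom>) w))"
  have W: "subspace (V\<^sup>\<bottom>)" by (rule subspace_orthogonal_comp)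
  have g_scale: "g (t *\<^sub>R w) = t * g w" if "t \<ge> 0" for t w
    using that by (simp add: g_def orth_proj_scaleR[OF W] algebra_simps)
  have F_add: "F (p + w) = (\<Sum>i\<in>I. infdist (p + w) (K i)) + g w" for w
    using infdist_flat[of p L w] V unfolding F_def g_def V_def by (simp add: dist_norm)
  have F_p: "F p = (\<Sum>i\<in>I. a i)"
    using F_add[of 0] g_scale[of 0 0] I by (simp add: a_def infdist_closest_point)
  have lower: "F p - v \<bullet> w + g w \<le> F (p + w)" for w
  proof -
    have "F p - v \<bullet> w = (\<Sum>i\<in>I. a i - u i \<bullet> w)"
      unfolding F_p v_def by (simp add: inner_sum_left sum_subtractf)
    also have "\<dots> \<le> (\<Sum>i\<in>I. infdist (p + w) (K i))"
    proof (rule sum_mono)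
      fix i assume "i \<in> I"
      with I infdist_ge_supporting[of "K i" p "p + w"]
      show "a i - u i \<bullet> w \<le> infdist (p + w) (K i)" by (simp add: a_def u_def)
    qed
    finally show ?thesis by (simp add: F_add)
  qed
  define c where "c = (\<lambda>w :: 'a. \<Sum>i\<in>I. (norm w)\<^sup>2 / (2 * a i))"
  have upper: "F (p + t *\<^sub>R w) \<le> F p + t * (g w - v \<bullet> w + t * c w)" if t: "t \<ge> 0" for t w
  proof -
    have "(\<Sum>i\<in>I. infdist (p + t *\<^sub>R w) (K i))
        \<le> (\<Sum>i\<in>I. a i - t * (u i \<bullet> w) + t\<^sup>2 * ((norm w)\<^sup>2 / (2 * a i)))"
    proof (rule sum_mono)
      fix i assume "i \<in> I"
      with I infdist_le_quadratic[of "K i" p t w]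
      show "infdist (p + t *\<^sub>R w) (K i)
          \<le> a i - t * (u i \<bullet> w) + t\<^sup>2 * ((norm w)\<^sup>2 / (2 * a i))"
        by (simp add: a_def u_def)
    qed
    also have "\<dots> = F p - t * (v \<bullet> w) + t\<^sup>2 * c w"
      unfolding F_p v_def c_def
      by (simp only: inner_sum_left sum.distrib sum_subtractf sum_distrib_left)
    finally show ?thesis
      by (simp add: F_add g_scale[OF t] algebra_simps power2_eq_square)
  qed
  have "(\<forall>x. F p \<le> F x) \<longleftrightarrow> (\<forall>w. v \<bullet> w \<le> g w)"
  proof (intro iffI allI)
    fix w assume min: "\<forall>x. F p \<le> F x"
    have "0 \<le> g w - v \<bullet> w + t * c w" if "t > 0" for t
    proof -
      have "0 \<le> t * (g w - v \<bullet> w + t * c w)"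
        using upper[of t w] min[rule_format, of "p + t *\<^sub>R w"] that by linarith
      then show ?thesis using that by (simp add: zero_le_mult_iff)
    qed
    then have ev: "eventually (\<lambda>t. 0 \<le> g w - v \<bullet> w + t * c w) (at_right 0)"
      by (intro eventually_at_right_less[THEN eventually_mono])
    have "((\<lambda>t. g w - v \<bullet> w + t * c w) \<longlongrightarrow> g w - v \<bullet> w + 0 * c w) (at_right 0)"
      by (intro tendsto_intros)
    from tendsto_lowerbound[OF this ev] show "v \<bullet> w \<le> g w" by simp
  next
    fix x assume "\<forall>w. v \<bullet> w \<le> g w"
    then show "F p \<le> F x"
      using lower[of "x - p"] by (smt (verit) add_diff_cancel_left' diff_add_cancel add.commute)
  qed
  then show ?thesis unfolding v_def g_def .
qed

section \<open>The linear condition and the Minkowski sum\<close>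

lemma mem_sum_cball_iff:
  "v \<in> C + cball 0 r \<longleftrightarrow> (\<exists>c\<in>C. norm (v - c) \<le> r)"
  for v :: "'a::euclidean_space"
proof
  assume "\<exists>c\<in>C. norm (v - c) \<le> r"
  then obtain c where "c \<in> C" "norm (v - c) \<le> r" by blast
  then have "c + (v - c) \<in> C + cball 0 r" by (intro set_plus_intro) auto
  then show "v \<in> C + cball 0 r" by simp
next
  assume "v \<in> C + cball 0 r"
  then obtain c e where "c \<in> C" "norm e \<le> r" "v = c + e" by (auto elim: set_plus_elim)
  then show "\<exists>c\<in>C. norm (v - c) \<le> r" by (intro bexI[of _ c]) auto
qed

text \<open>The inequality says that \<open>v\<close> is bounded by the support function of the sum. For the
  direction that would need separation, let \<open>c\<close> be the point of \<open>V\<^sup>\<bottom> \<inter> cball 0 1\<close> nearest to \<open>v\<close>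
  and \<open>r = v - c\<close>. Then \<open>c\<close> maximizes \<open>x \<bullet> r\<close> among the points \<open>x\<close> of this set, so \<open>c \<bullet> r\<close> is at least the norm of
  the part of \<open>r\<close> in \<open>V\<^sup>\<bottom>\<close>, and the inequality for \<open>w = r\<close> collapses to \<open>r \<bullet> r \<le> norm r\<close>.\<close>

lemma linear_bound_iff_mem_sum:
  fixes V :: "'a::euclidean_space set"
  assumes V: "subspace V"
  shows "(\<forall>w. v \<bullet> w \<le> norm w + norm (orth_proj (V\<^sup>\<bottom>) w)) \<longleftrightarrow> v \<in> (V\<^sup>\<bottom> \<inter> cball 0 1) + cball 0 1"
proof -
  let ?C = "V\<^sup>\<bottom> \<inter> cball 0 1" and ?Q = "orth_proj (V\<^sup>\<bottom>)"
  have W: "subspace (V\<^sup>\<bottom>)" by (rule subspace_orthogonal_comp)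
  have inner_Q: "c \<bullet> w = c \<bullet> ?Q w" if "c \<in> V\<^sup>\<bottom>" for c w
  proof -
    have "orth_proj V w \<bullet> c = 0"
      using orth_proj(1)[OF V, of w] that by (simp add: orthogonal_comp_def orthogonal_def)
    then show ?thesis
      by (simp add: orth_proj_orthogonal_comp[OF V] inner_diff_right inner_commute)
  qed
  show ?thesis
  proof
    assume bound: "\<forall>w. v \<bullet> w \<le> norm w + norm (?Q w)"
    define c where "c = closest_point ?C v"
    define r where "r = v - c"
    have C: "closed ?C" "convex ?C" "?C \<noteq> {}"
      using W subspace_0[OF W]
      by (auto intro: closed_Int closed_subspace convex_Int subspace_imp_convex)
    have c: "c \<in> ?C" unfolding c_def by (rule closest_point_in_set[OF C(1,3)])
    \<comment> \<open>The unit vector along \<open>?Q r\<close>; it is \<open>0\<close> if \<open>?Q r = 0\<close>.\<close>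
    define e where "e = ?Q r /\<^sub>R norm (?Q r)"
    have "e \<in> ?C"
      using orth_proj(1)[OF W, of r] W
      by (cases "?Q r = 0") (simp_all add: e_def subspace_0 subspace_scale)
    then have "r \<bullet> (e - c) \<le> 0"
      unfolding r_def c_def by (rule closest_point_dot[OF C(2,1)])
    moreover have "r \<bullet> e = norm (?Q r)"
    proof -
      have "r \<bullet> e = e \<bullet> ?Q r"
        using inner_Q[of e r] \<open>e \<in> ?C\<close> by (simp add: inner_commute)
      also have "\<dots> = norm (?Q r)"
        by (cases "?Q r = 0") (simp_all add: e_def power2_norm_eq_inner[symmetric] power2_eq_square)
      finally show ?thesis .
    qed
    ultimately have "norm (?Q r) \<le> c \<bullet> r" by (simp add: inner_diff_right inner_commute)
    moreover have "v \<bullet> r = norm r * norm r + c \<bullet> r"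
      using inner_add_left[of r c r] by (simp add: dot_square_norm power2_eq_square) (simp add: r_def)
    ultimately have "norm r * norm r \<le> norm r * 1" using bound[rule_format, of r] by simp
    then have "norm r \<le> 1"
      by (metis mult_le_cancel_left_pos norm_ge_zero order_le_less zero_le_one)
    then show "v \<in> ?C + cball 0 1" using c unfolding mem_sum_cball_iff r_def by blast
  next
    assume "v \<in> ?C + cball 0 1"
    then obtain c where c: "c \<in> V\<^sup>\<bottom>" "norm c \<le> 1" "norm (v - c) \<le> 1"
      unfolding mem_sum_cball_iff by auto
    show "\<forall>w. v \<bullet> w \<le> norm w + norm (?Q w)"
    proof
      fix w
      have "v \<bullet> w = (v - c) \<bullet> w + c \<bullet> ?Q w"
        using inner_Q[OF c(1), of w] by (simp add: inner_diff_left)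
      also have "\<dots> \<le> norm (v - c) * norm w + norm c * norm (?Q w)"
        by (intro add_mono norm_cauchy_schwarz)
      also have "\<dots> \<le> 1 * norm w + 1 * norm (?Q w)"
        by (intro add_mono mult_right_mono c(2,3)) auto
      finally show "v \<bullet> w \<le> norm w + norm (?Q w)" by simp
    qed
  qed
qed

section \<open>The Minkowski sum in polar coordinates\<close>

text \<open>The point of \<open>V\<^sup>\<bottom> \<inter> cball 0 1\<close> nearest to \<open>v\<close> arises from the part of \<open>v\<close> in \<open>V\<^sup>\<bottom>\<close> by
  truncating it to length at most \<open>1\<close>, so that its distance to \<open>v\<close> is explicit.\<close>

lemma mem_sum_iff:
  fixes V :: "'a::euclidean_space set"
  assumes V: "subspace V"
  shows "v \<in> (V\<^sup>\<bottom> \<inter> cball 0 1) + cball 0 1 \<longleftrightarrow>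
    (norm (orth_proj V v))\<^sup>2 + (max 0 (norm (orth_proj (V\<^sup>\<bottom>) v) - 1))\<^sup>2 \<le> 1"
proof -
  let ?P = "orth_proj V v" and ?Q = "orth_proj (V\<^sup>\<bottom>) v"
  have W: "subspace (V\<^sup>\<bottom>)" by (rule subspace_orthogonal_comp)
  have dist_C: "(norm (v - c))\<^sup>2 = (norm ?P)\<^sup>2 + (norm (?Q - c))\<^sup>2" if "c \<in> V\<^sup>\<bottom>" for c
    using norm_diff_Pythagorean_subspace[OF W that, of v] V by (simp add: orthogonal_comp_self)
  show ?thesis
  proof
    assume "v \<in> (V\<^sup>\<bottom> \<inter> cball 0 1) + cball 0 1"
    then obtain c where c: "c \<in> V\<^sup>\<bottom>" "norm c \<le> 1" "norm (v - c) \<le> 1"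
      unfolding mem_sum_cball_iff by auto
    have "max 0 (norm ?Q - 1) \<le> norm (?Q - c)"
      using c(2) norm_triangle_ineq2[of ?Q c] by simp
    then have "(max 0 (norm ?Q - 1))\<^sup>2 \<le> (norm (?Q - c))\<^sup>2" by (rule power_mono) simp
    moreover have "(norm (v - c))\<^sup>2 \<le> 1" using c(3) by (simp add: power_le_one)
    ultimately show "(norm ?P)\<^sup>2 + (max 0 (norm ?Q - 1))\<^sup>2 \<le> 1" using dist_C[OF c(1)] by linarith
  next
    assume le: "(norm ?P)\<^sup>2 + (max 0 (norm ?Q - 1))\<^sup>2 \<le> 1"
    define m where "m = max 1 (norm ?Q)"
    define c where "c = ?Q /\<^sub>R m"
    have m: "m \<ge> 1" "norm ?Q \<le> m" by (auto simp: m_def)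
    have c: "c \<in> V\<^sup>\<bottom>" "norm c \<le> 1"
      using orth_proj(1)[OF W, of v] W m by (simp_all add: c_def subspace_scale field_simps)
    have "?Q - c = (1 - inverse m) *\<^sub>R ?Q" by (simp add: c_def scaleR_diff_left)
    then have "norm (?Q - c) = (1 - inverse m) * norm ?Q"
      using m by (simp add: inverse_le_1_iff)
    also have "\<dots> = max 0 (norm ?Q - 1)"
      by (auto simp: m_def max_def field_simps)
    finally have "(norm (v - c))\<^sup>2 \<le> 1" using le dist_C[OF c(1)] by simp
    then have "norm (v - c) \<le> 1" by (simp add: power2_le_imp_le)
    then show "v \<in> (V\<^sup>\<bottom> \<inter> cball 0 1) + cball 0 1"
      using c unfolding mem_sum_cball_iff by auto
  qed
qed

text \<open>Here \<open>(a, b) = (N * cos \<alpha>, N * sin \<alpha>)\<close>. Below the diagonal, \<open>a \<le> 1\<close> forces \<open>b \<le> 1\<close>, so only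
  the line \<open>a = 1\<close> matters. Above it, the region is the part of the unit disc
  \<open>a\<^sup>2 + b\<^sup>2 \<le> 2 * b\<close> around \<open>(0, 1)\<close>; where \<open>b \<le> 1\<close>, the region and the disc both contain every
  point with \<open>a \<le> b\<close>.\<close>

lemma polar_region_iff:
  fixes N \<alpha> :: real
  assumes N: "N > 0" and \<alpha>: "\<alpha> \<in> {0..pi/2}"
  shows "(N * cos \<alpha>)\<^sup>2 + (max 0 (N * sin \<alpha> - 1))\<^sup>2 \<le> 1 \<longleftrightarrow>
    N \<le> (if \<alpha> \<le> pi / 4 then 1 / cos \<alpha> else 2 * sin \<alpha>)"
proof -
  define a b where "a = N * cos \<alpha>" and "b = N * sin \<alpha>"
  have a0: "a \<ge> 0" and b0: "b \<ge> 0"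
    using N \<alpha> by (simp_all add: a_def b_def cos_ge_zero sin_ge_zero)
  have ab: "a\<^sup>2 + b\<^sup>2 = N\<^sup>2"
    unfolding a_def b_def power_mult_distrib distrib_left[symmetric] by simp
  show ?thesis unfolding a_def[symmetric] b_def[symmetric]
  proof (cases "\<alpha> \<le> pi / 4")
    case True
    have cos: "cos \<alpha> > 0" using \<alpha> True pi_gt_zero unfolding atLeastAtMost_iff
      by (intro cos_gt_zero_pi) linarith+
    have "sin \<alpha> \<le> cos \<alpha>"
    proof -
      have "sin \<alpha> \<le> sin (pi / 2 - \<alpha>)"
        using \<alpha> True by (intro sin_monotone_2pi_le) auto
      then show ?thesis by (simp add: sin_diff)
    qed
    then have ba: "b \<le> a" using N by (simp add: a_def b_def)
    have "a\<^sup>2 + (max 0 (b - 1))\<^sup>2 \<le> 1 \<longleftrightarrow> a \<le> 1"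
    proof
      assume "a\<^sup>2 + (max 0 (b - 1))\<^sup>2 \<le> 1"
      then have "a\<^sup>2 \<le> 1\<^sup>2"
        using zero_le_power2[of "max 0 (b - 1)"] unfolding power_one by linarith
      then show "a \<le> 1" by (rule power2_le_imp_le) simp
    next
      assume "a \<le> 1"
      then show "a\<^sup>2 + (max 0 (b - 1))\<^sup>2 \<le> 1" using ba a0 by (simp add: power_le_one)
    qed
    also have "\<dots> \<longleftrightarrow> N \<le> 1 / cos \<alpha>" using cos by (simp add: a_def field_simps)
    finally show "a\<^sup>2 + (max 0 (b - 1))\<^sup>2 \<le> 1 \<longleftrightarrow>
      N \<le> (if \<alpha> \<le> pi / 4 then 1 / cos \<alpha> else 2 * sin \<alpha>)" using True by simp
  next
    case False
    have "cos \<alpha> \<le> sin \<alpha>"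
    proof -
      have "sin (pi / 2 - \<alpha>) \<le> sin \<alpha>"
        using \<alpha> False by (intro sin_monotone_2pi_le) auto
      then show ?thesis by (simp add: sin_diff)
    qed
    then have ab_le: "a \<le> b" using N by (simp add: a_def b_def)
    then have sq_le: "a\<^sup>2 \<le> b\<^sup>2" using a0 by (rule power_mono)
    have "a\<^sup>2 + (max 0 (b - 1))\<^sup>2 \<le> 1 \<longleftrightarrow> a\<^sup>2 + b\<^sup>2 \<le> 2 * b"
    proof (cases "b \<le> 1")
      case True
      then have "a\<^sup>2 \<le> 1" using ab_le a0 by (intro power_le_one) auto
      moreover have "b\<^sup>2 \<le> b" using mult_left_mono[OF True b0] by (simp add: power2_eq_square)
      ultimately show ?thesis using True sq_le by simp
    next
      case False
      then show ?thesis by (auto simp: power2_diff)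
    qed
    also have "\<dots> \<longleftrightarrow> N * N \<le> N * (2 * sin \<alpha>)"
      unfolding ab by (simp add: b_def power2_eq_square algebra_simps)
    also have "\<dots> \<longleftrightarrow> N \<le> 2 * sin \<alpha>" using N by simp
    finally show "a\<^sup>2 + (max 0 (b - 1))\<^sup>2 \<le> 1 \<longleftrightarrow>
      N \<le> (if \<alpha> \<le> pi / 4 then 1 / cos \<alpha> else 2 * sin \<alpha>)" using False by simp
  qed
qed

lemma mem_sum_iff_angle:
  fixes V :: "'a::euclidean_space set" and v :: 'a
  assumes V: "subspace V"
  defines "\<alpha> \<equiv> if v = 0 then 0 else subspace_angle v V"
  shows "v \<in> (V\<^sup>\<bottom> \<inter> cball 0 1) + cball 0 1 \<longleftrightarrow>
    norm v \<le> (if \<alpha> \<le> pi / 4 then 1 / cos \<alpha> else 2 * sin \<alpha>)"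
proof (cases "v = 0")
  case True
  have "0 \<in> V\<^sup>\<bottom> \<inter> cball 0 1" by (simp add: subspace_0 subspace_orthogonal_comp)
  then show ?thesis using True unfolding mem_sum_cball_iff by (auto simp: \<alpha>_def)
next
  case False
  note angle = subspace_angle[OF V False]
  have "norm (orth_proj V v) = norm v * cos \<alpha>" "norm (orth_proj (V\<^sup>\<bottom>) v) = norm v * sin \<alpha>"
    using False angle(2,3) by (simp_all add: \<alpha>_def)
  then show ?thesis
    using polar_region_iff[of "norm v" \<alpha>] False angle(1) by (simp add: mem_sum_iff[OF V] \<alpha>_def)
qed

section \<open>Characterization of minimizers\<close>

theorem theorem5p3:
  fixes K :: "nat \<Rightarrow> 'a::euclidean_space set" and n :: nat and xbar v :: 'a and \<alpha> :: real
    and f :: "'a \<Rightarrow> real"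
  assumes "n \<ge> 2"
    and "\<And>i. i \<in> {1..n} \<Longrightarrow> K i \<noteq> {} \<and> closed (K i) \<and> convex (K i)"
    and "K (n - 1) = {xbar}" and "{xbar} \<subseteq> K n"
    and "xbar \<notin> (\<Union>i\<in>{1..n - 2}. K i)"
    and "affine (K n)" and "aff_dim (K n) \<in> {1..int DIM('a) - 1}"
    and "v = (\<Sum>i\<in>{1..n - 2}.
           (closest_point (K i) xbar - xbar) /\<^sub>R norm (closest_point (K i) xbar - xbar))"
    and "\<alpha> = (if v = 0 then 0 else subspace_angle v ((\<lambda>y. y - xbar) ` K n))"
    and "f = (\<lambda>x. \<Sum>i\<in>{1..n}. infdist x (K i))"
  shows "((\<forall>x. f xbar \<le> f x) \<longleftrightarrow>
            v \<in> (((\<lambda>y. y - xbar) ` K n)\<^sup>\<bottom> \<inter> cball 0 1) + cball 0 1)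
       \<and> (v \<in> (((\<lambda>y. y - xbar) ` K n)\<^sup>\<bottom> \<inter> cball 0 1) + cball 0 1 \<longleftrightarrow>
            norm v \<le> (if \<alpha> \<le> pi / 4 then 1 / cos \<alpha> else 2 * sin \<alpha>))"
proof -
  define V where "V = (\<lambda>y. y - xbar) ` K n"
  have V: "subspace V"
    unfolding V_def using assms(4,6) by (intro affine_diffs_subspace_subtract) auto
  define F where "F = (\<lambda>x. (\<Sum>i\<in>{1..n - 2}. infdist x (K i)) + dist x xbar + infdist x (K n))"
  have "f = F"
  proof
    fix x
    have "{1..n} = insert n (insert (n - 1) {1..n - 2})"
      and "n \<notin> insert (n - 1) {1..n - 2}" and "n - 1 \<notin> {1..n - 2}"
      using assms(1) by auto
    then show "f x = F x" using assms(3) by (simp add: assms(10) F_def)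
  qed
  moreover have "(\<forall>x. F xbar \<le> F x) \<longleftrightarrow> (\<forall>w. v \<bullet> w \<le> norm w + norm (orth_proj (V\<^sup>\<bottom>) w))"
    unfolding F_def V_def assms(8)
    by (rule minimizer_iff_linear_bound) (use assms(2,5) V[unfolded V_def] in auto)
  ultimately show ?thesis
    using linear_bound_iff_mem_sum[OF V, of v] mem_sum_iff_angle[OF V, of v]
    unfolding assms(9) V_def by simp
qed

end
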